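(* Let $\mathrm{Domb}(n)=\sum_{k=0}^{n}\binom{n}{k}^2\binom{2k}{k}\binom{2(n-k)}{n-k}$. Then \begin{align*} &\sum_{n=0}^{\infty}\frac{27+103n+141n^2+78n^3+15n^4}{(n+1)^2(n+2)^2}\frac{\mathrm{Domb}(n)}{(-32)^n}=\frac{18}{\pi},\\ &\sum_{n=0}^{\infty}\frac{239+807n+993n^2+582n^3+165n^4+18n^5}{(n+1)^3(n+2)^3}\frac{\mathrm{Domb}(n)}{(-32)^n}=80-\frac{162}{\pi},\\ &\sum_{n=2}^{\infty}\frac{2+5n-9n^2-21n^3+39n^4}{n^2(n-1)^2}\frac{\mathrm{Domb}(n)}{(-32)^n}=-9\left(\frac{2}{\pi}-\frac{11}{12}\right),\\ &\sum_{n=2}^{\infty}\frac{-26-21n+105n^2-9n^3-147n^4+306n^5}{n^3(n-1)^3}\frac{\mathrm{Domb}(n)}{(-32)^n}=\frac{162}{\pi}-\frac{217}{8},\\ &\sum_{n=0}^{\infty}\frac{5729+8701n+5895n^2+1879n^3+228n^4}{(n+1)^2(n+2)^2(n+3)^2}\frac{\mathrm{Domb}(n)}{(-32)^n}=\frac{486}{\pi}. \end{align*} *)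

theory Defs
  imports Complex_Main
begin

definition Domb :: "nat \<Rightarrow> nat" where
  "Domb n = (\<Sum>k=0..n. (n choose k)^2 * ((2*k) choose k) * ((2*(n-k)) choose (n-k)))"

end

theory Submission
  imports Defs "HOL-Complex_Analysis.Complex_Analysis" "HOL-Real_Asymp.Real_Asymp"
begin

text \<open>
  All five series reduce to \<open>\<Sum>n. (1 + 3n) Domb(n) / (-32)\<^sup>n = 2 / \<pi>\<close> by telescoping with the three-term
  recurrence of the Domb numbers. For the latter, write \<open>f(y) = \<Sum>k. (1/2)\<^sub>k (1/3)\<^sub>k (2/3)\<^sub>k / k!\<^sup>3 y\<^sup>k\<close>. Then
  \<open>\<Sum>n. Domb(n) (-t)\<^sup>n = f(y) / (1 + 16t)\<close> with \<open>y = 108t / (1 + 16t)\<^sup>3\<close>, because the Taylor coefficients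
  of both sides satisfy the same recurrence. As
  \<open>1 - y = (1 - 32t)\<^sup>2 (1 + 4t) / (1 + 16t)\<^sup>3\<close>, the point \<open>t = 1/32\<close> is a critical point of \<open>y\<close> and is
  mapped to the singularity \<open>y = 1\<close> of \<open>f\<close>. Applying \<open>1 + 3 t d/dt\<close> gives
  \<open>(1 - 32t) / (1 + 16t)\<^sup>2\<close> times \<open>\<Sum>k. (1 + 3k) (1/2)\<^sub>k (1/3)\<^sub>k (2/3)\<^sub>k / k!\<^sup>3 y\<^sup>k\<close>, and as \<open>t\<close> tends to
  \<open>1/32\<close> the zero of the first factor cancels the inverse square root singularity of the second. The
  coefficient of that singularity is read off from the asymptotics of the Pochhammer symbols, where
  \<open>\<Gamma>(1/3) \<Gamma>(2/3) = 2 \<pi> / \<surd>3\<close> produces the \<open>\<pi>\<close>.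
\<close>

section \<open>The recurrence of the Domb numbers\<close>

definition domb_summand :: "nat \<Rightarrow> nat \<Rightarrow> real" where
  "domb_summand n k = real ((n choose k)^2 * ((2*k) choose k) * ((2*(n-k)) choose (n-k)))"

lemma domb_summand_eq_0: "n < k \<Longrightarrow> domb_summand n k = 0"
  by (simp add: domb_summand_def)

text \<open>Writing n = k + j removes the truncated subtraction and leaves a pure quotient of
  factorials, from which both shift relations below follow by cancellation.\<close>

lemma domb_summand_fact:
  "domb_summand (k + j) k
     = fact (k + j)^2 * fact (2*k) * fact (2*j) / (fact k^4 * fact j^4)"
proof -
  have "real ((2*i) choose i) = fact (2*i) / (fact i * fact i)" for i
    by (subst binomial_fact) (auto simp: mult_2)
  moreover have "real ((k + j) choose k) = fact (k + j) / (fact k * fact j)"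
    by (subst binomial_fact) auto
  ultimately show ?thesis
    by (simp add: domb_summand_def power_divide power_mult_distrib power4_eq_xxxx power2_eq_square)
qed

lemma fact_double_Suc:
  "(fact (2 * (k + 1)) :: real) = 2 * (real k + 1) * (2 * real k + 1) * fact (2 * k)"
proof -
  have "2 * (k + 1) = Suc (Suc (2 * k))" by simp
  then show ?thesis by (simp only: fact_Suc) (simp add: add_ac)
qed

lemma fact_Suc_real: "(fact (k + 1) :: real) = (real k + 1) * fact k"
  by simp

text \<open>The shift ratio is cross-multiplied so that it survives at k = n + 1, where both sides
  vanish.\<close>

lemma domb_summand_Suc_left:
  assumes "k \<le> n + 1"
  shows "domb_summand (n + 1) k * (real n + 1 - real k)^3
       = domb_summand n k * (2 * (real n + 1)^2 * (2 * real n - 2 * real k + 1))"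
proof (cases "k = n + 1")
  case True
  then show ?thesis by (simp add: domb_summand_eq_0)
next
  case False
  then obtain j where n: "n = k + j" using assms by (metis le_Suc_eq le_add1 nat_le_iff_add Suc_eq_plus1)
  \<comment> \<open>The factorials become free variables, so this is a plain rational identity;
    \<open>a\<close> stands for j + 1.\<close>
  have cancel: "(c * d)^2 * f * (2 * a * s * g) / (p * (a * q)^4) * a^3
      = d^2 * f * g / (p * q^4) * (2 * c^2 * s)" if "a \<noteq> 0" for a c d f g p q s :: real
    using that by (simp add: power_mult_distrib power_numeral_reduce)
  have "domb_summand (k + j + 1) k * (real j + 1)^3
      = domb_summand (k + j) k * (2 * (real (k + j) + 1)^2 * (2 * real j + 1))"
    unfolding add.assoc[of k j 1] domb_summand_fact
    unfolding add.assoc[of k j 1, symmetric] fact_double_Suc fact_Suc_real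
    by (rule cancel) simp
  then show ?thesis by (simp add: n)
qed

lemma domb_summand_Suc_right:
  assumes "k \<le> n"
  shows "domb_summand n (k + 1) * ((real k + 1)^3 * (2 * real n - 2 * real k - 1))
       = domb_summand n k * ((real n - real k)^3 * (2 * real k + 1))"
proof (cases "k = n")
  case True
  then show ?thesis by (simp add: domb_summand_eq_0)
next
  case False
  then obtain j where n: "n = (k + 1) + j"
    using assms by (metis nat_le_iff_add le_neq_implies_less Suc_eq_plus1 Suc_leI)
  have eq: "k + 1 + j = k + (j + 1)" by simp
  have cancel: "c * (2 * a * s * f) * g / ((a * p)^4 * q^4) * (a^3 * t)
      = c * f * (2 * b * t * g) / (p^4 * (b * q)^4) * (b^3 * s)"
    if "a \<noteq> 0" "b \<noteq> 0" for a b c f g p q s t :: real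
    using that by (simp add: power_mult_distrib power_numeral_reduce)
  have "domb_summand ((k + 1) + j) (k + 1) * ((real k + 1)^3 * (2 * real j + 1))
      = domb_summand (k + (j + 1)) k * ((real j + 1)^3 * (2 * real k + 1))"
    unfolding domb_summand_fact unfolding eq fact_double_Suc fact_Suc_real
    by (rule cancel) simp_all
  then show ?thesis unfolding n eq by (simp add: add_ac)
qed

lemma Domb_eq_sum:
  assumes "n \<le> m"
  shows "real (Domb n) = (\<Sum>k\<le>m. domb_summand n k)"
proof -
  have "real (Domb n) = (\<Sum>k\<le>n. domb_summand n k)"
    by (simp add: Domb_def domb_summand_def atLeast0AtMost)
  also have "\<dots> = (\<Sum>k\<le>m. domb_summand n k)"
    by (rule sum.mono_neutral_left) (use assms in \<open>auto simp: domb_summand_eq_0\<close>)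
  finally show ?thesis .
qed

text \<open>An operator rather than an equation: creative telescoping applies it to single summands,
  where its value is a difference in k instead of 0.\<close>

definition domb_rec :: "(nat \<Rightarrow> real) \<Rightarrow> nat \<Rightarrow> real" where
  "domb_rec u n = (real n + 2)^3 * u (n + 2)
     - 2 * (2 * real n + 3) * (5 * real n^2 + 15 * real n + 12) * u (n + 1)
     + 64 * (real n + 1)^3 * u n"

text \<open>The leading coefficient (n + 2)^3 never vanishes, so two initial values determine a
  solution.\<close>

lemma domb_rec_eq_0_unique:
  assumes "\<And>n. domb_rec u n = 0" "\<And>n. domb_rec v n = 0" "u 0 = v 0" "u 1 = v 1"
  shows "u n = v n"
proof (induction n rule: less_induct)
  case (less n)
  consider "n = 0" | "n = 1" | m where "n = m + 2"
    by (metis One_nat_def Suc_1 add.commute add_2_eq_Suc' not0_implies_Suc)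
  then show ?case
  proof cases
    case (3 m)
    have "(real m + 2)^3 * u (m + 2) = (real m + 2)^3 * v (m + 2)"
    proof -
      have eqs: "u m = v m" "u (m + 1) = v (m + 1)"
        using less[of m] less[of "m + 1"] 3 by simp_all
      show ?thesis
        using assms(1)[of m] assms(2)[of m] unfolding domb_rec_def eqs by linarith
    qed
    moreover have "real m + 2 \<noteq> 0" by linarith
    ultimately show ?thesis using 3 by simp
  qed (use assms in auto)
qed

lemma domb_rec_sum:
  "domb_rec (\<lambda>n. \<Sum>k\<in>A. F n k) n = (\<Sum>k\<in>A. domb_rec (\<lambda>n. F n k) n)"
  by (simp add: domb_rec_def sum.distrib sum_subtractf sum_distrib_left)

lemma domb_rec_cong:
  "u n = v n \<Longrightarrow> u (n + 1) = v (n + 1) \<Longrightarrow> u (n + 2) = v (n + 2) \<Longrightarrow> domb_rec u n = domb_rec v n"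
  by (simp add: domb_rec_def)

text \<open>The certificate \<open>G\<close> comes from creative telescoping, as does the one for
  \<open>cubic_summand\<close> below.\<close>

lemma domb_rec_domb_summand:
  fixes n :: nat
  defines "q \<equiv> \<lambda>x. 4*x^3 - 6*(3*real n + 5)*x^2 + (26*real n^2 + 89*real n + 74)*x
                    - 2*(6*real n^3 + 31*real n^2 + 52*real n + 28)"
  defines "G \<equiv> \<lambda>k. real k^3 * q (real k) / ((real n + 2)^2 * (2*real n - 2*real k + 3))
                    * domb_summand (n + 2) k"
  assumes k: "k \<le> n + 2"
  shows "domb_rec (\<lambda>n. domb_summand n k) n = G (k + 1) - G k"
proof -
  define x where "x = real k"
  define y where "y = real n"
  define a where "a = 2*y - 2*x + 3"
  define b where "b = 2*y - 2*x + 1"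
  \<comment> \<open>Both are odd integers, hence nonzero even where k > n makes them
    negative.\<close>
  have "a = real_of_int (2 * (int n - int k + 1) + 1)" "b = real_of_int (2 * (int n - int k) + 1)"
    by (simp_all add: a_def b_def x_def y_def)
  then have ab: "a \<noteq> 0" "b \<noteq> 0"
    by (metis of_int_eq_0_iff even_plus_one_iff dvd_triv_left odd_one even_zero)+
  have xy: "y + 1 \<noteq> 0" "y + 2 \<noteq> 0" by (simp_all add: x_def y_def add_nonneg_eq_0_iff)
  \<comment> \<open>A common factor: the three shifted summands and both certificate values become
    polynomial multiples of \<open>Z\<close>, which reduces the claim to a polynomial
    identity.\<close>
  define Z where "Z = domb_summand (n + 2) k / (4 * (y + 1)^2 * (y + 2)^2 * a * b)"
  have F2: "domb_summand (n + 2) k = 4 * (y + 1)^2 * (y + 2)^2 * a * b * Z"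
    using ab xy by (simp add: Z_def)
  have "domb_summand (n + 1) k * (2 * (y + 2)^2 * a) = domb_summand (n + 2) k * (y + 2 - x)^3"
    using domb_summand_Suc_left[of k "n + 1"] k
    by (simp add: x_def y_def a_def add_ac algebra_simps)
  also have "\<dots> = (2 * (y + 1)^2 * b * (y + 2 - x)^3 * Z) * (2 * (y + 2)^2 * a)"
    unfolding F2 by simp
  finally have F1: "domb_summand (n + 1) k = 2 * (y + 1)^2 * b * (y + 2 - x)^3 * Z"
    using ab xy by simp
  have F0: "domb_summand n k = ((y + 1 - x) * (y + 2 - x))^3 * Z"
  proof (cases "k \<le> n + 1")
    case True
    have "domb_summand n k * (2 * (y + 1)^2 * b) = domb_summand (n + 1) k * (y + 1 - x)^3"
      using domb_summand_Suc_left[OF True] by (simp add: x_def y_def b_def)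
    also have "\<dots> = (((y + 1 - x) * (y + 2 - x))^3 * Z) * (2 * (y + 1)^2 * b)"
      unfolding F1 by (simp add: power_mult_distrib)
    finally show ?thesis using ab xy by simp
  next
    case False
    then have "k = n + 2" using k by simp
    then show ?thesis by (simp add: domb_summand_eq_0 x_def y_def)
  qed
  have "domb_summand (n + 2) (k + 1) * ((x + 1)^3 * a)
      = domb_summand (n + 2) k * ((y + 2 - x)^3 * (2 * x + 1))"
    using domb_summand_Suc_right[OF k] by (simp add: x_def y_def a_def algebra_simps)
  also have "\<dots> = (4 * (y + 1)^2 * (y + 2)^2 * b * Z * (y + 2 - x)^3 * (2 * x + 1)) * a"
    unfolding F2 by simp
  finally have F2': "domb_summand (n + 2) (k + 1) * (x + 1)^3
      = 4 * (y + 1)^2 * (y + 2)^2 * b * Z * (y + 2 - x)^3 * (2 * x + 1)"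
    using ab by simp
  have "G (k + 1) = q (x + 1) / ((y + 2)^2 * b) * (domb_summand (n + 2) (k + 1) * (x + 1)^3)"
    by (simp add: G_def x_def y_def b_def algebra_simps)
  also have "\<dots> = 4 * (y + 1)^2 * q (x + 1) * (y + 2 - x)^3 * (2 * x + 1) * Z"
    unfolding F2' using ab xy by (simp add: field_simps)
  finally have G1: "G (k + 1) = 4 * (y + 1)^2 * q (x + 1) * (y + 2 - x)^3 * (2 * x + 1) * Z" .
  have "G k = x^3 * q x / ((y + 2)^2 * a) * (4 * (y + 1)^2 * (y + 2)^2 * a * b * Z)"
    unfolding F2[symmetric] by (simp add: G_def x_def y_def a_def)
  also have "\<dots> = 4 * (y + 1)^2 * x^3 * q x * b * Z"
    using ab xy by (simp add: field_simps)
  finally have G0: "G k = 4 * (y + 1)^2 * x^3 * q x * b * Z" .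
  show ?thesis
    unfolding domb_rec_def F0 F1 F2 G0 G1 y_def[symmetric]
    unfolding q_def a_def b_def y_def[symmetric] by algebra
qed

lemma domb_rec_Domb: "domb_rec (\<lambda>n. real (Domb n)) n = 0"
proof -
  define q where "q = (\<lambda>x. 4*x^3 - 6*(3*real n + 5)*x^2 + (26*real n^2 + 89*real n + 74)*x
                    - 2*(6*real n^3 + 31*real n^2 + 52*real n + 28))"
  define G where "G = (\<lambda>k. real k^3 * q (real k) / ((real n + 2)^2 * (2*real n - 2*real k + 3))
                    * domb_summand (n + 2) k)"
  \<comment> \<open>Rows n, n + 1 and n + 2 need a common summation range; the additional summands
    are 0.\<close>
  have "domb_rec (\<lambda>n. real (Domb n)) n = domb_rec (\<lambda>m. \<Sum>k\<le>n+2. domb_summand m k) n"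
    by (intro domb_rec_cong Domb_eq_sum) auto
  also have "\<dots> = (\<Sum>k<n+3. G (Suc k) - G k)"
    unfolding domb_rec_sum
  proof (rule sum.cong)
    show "domb_rec (\<lambda>m. domb_summand m k) n = G (Suc k) - G k" if "k \<in> {..<n+3}" for k
      using domb_rec_domb_summand[of k n] that by (simp add: G_def q_def)
  qed auto
  also have "\<dots> = G (n + 3) - G 0"
    by (rule sum_lessThan_telescope)
  \<comment> \<open>\<open>G 0\<close> carries the factor k^3, and at k = n + 3 the summand of row n
    + 2 is 0.\<close>
  also have "\<dots> = 0"
    by (simp add: G_def domb_summand_eq_0)
  finally show ?thesis .
qed

text \<open>For fixed \<open>k\<close>, the coefficient of \<open>z\<^sup>n\<close> in
  \<open>C(2k,k)\<^sup>2 C(3k,k) (-z)\<^sup>k / (1 - 16z)\<^bsup>3k+1\<^esup>\<close>.\<close>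

definition cubic_summand :: "nat \<Rightarrow> nat \<Rightarrow> real" where
  "cubic_summand n k = (-1)^k * real (((2*k) choose k)^2 * ((3*k) choose k) * ((n + 2*k) choose (3*k)))
     * 16^n / 16^k"

lemma cubic_summand_eq_0: "n < k \<Longrightarrow> cubic_summand n k = 0"
  by (simp add: cubic_summand_def)

lemma cubic_summand_fact:
  "cubic_summand (k + j) k = (-1)^k * fact (2*k) * fact (3*k + j) * 16^j / (fact k^5 * fact j)"
proof -
  have 1: "real ((2*k) choose k) = fact (2*k) / (fact k * fact k)"
    by (subst binomial_fact) (auto simp: mult_2)
  have 2: "real ((3*k) choose k) = fact (3*k) / (fact k * fact (2*k))"
    by (subst binomial_fact) auto
  have 3: "real ((k + j + 2*k) choose (3*k)) = fact (3*k + j) / (fact (3*k) * fact j)"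
    by (subst binomial_fact) (auto simp: add_ac)
  have 4: "(16::real)^(k + j) / 16^k = 16^j"
    by (simp add: power_add)
  have "cubic_summand (k + j) k = (-1)^k * ((real ((2*k) choose k))^2 * real ((3*k) choose k)
          * real ((k + j + 2*k) choose (3*k))) * (16^(k + j) / 16^k)"
    by (simp add: cubic_summand_def)
  then show ?thesis
    unfolding 1 2 3 4 by (simp add: field_simps power_numeral_reduce)
qed

lemma cubic_summand_Suc_left:
  assumes "k \<le> n + 1"
  shows "cubic_summand (n + 1) k * (real n + 1 - real k)
       = cubic_summand n k * (16 * (real n + 1 + 2 * real k))"
proof (cases "k = n + 1")
  case True
  then show ?thesis by (simp add: cubic_summand_eq_0)
next
  case False
  then obtain j where n: "n = k + j" using assms by (metis le_Suc_eq nat_le_iff_add Suc_eq_plus1)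
  have *: "k + j + 1 = k + (j + 1)" "3 * k + (j + 1) = Suc (3 * k + j)" by simp_all
  have "cubic_summand (k + j + 1) k * (real j + 1)
      = cubic_summand (k + j) k * (16 * (real (k + j) + 1 + 2 * real k))"
    unfolding *(1) cubic_summand_fact unfolding *(2)
    by (simp add: divide_simps) (simp add: algebra_simps)
  then show ?thesis by (simp add: n)
qed

lemma cubic_summand_Suc_right:
  assumes "k \<le> n"
  shows "cubic_summand n (k + 1) * (8 * (real k + 1)^4)
       = - cubic_summand n k * ((2*real k + 1) * (real n + 2*real k + 1) * (real n + 2*real k + 2)
           * (real n - real k))"
proof (cases "k = n")
  case True
  then show ?thesis by (simp add: cubic_summand_eq_0)
next
  case False
  then obtain j where n: "n = (k + 1) + j"
    using assms by (metis nat_le_iff_add le_neq_implies_less Suc_eq_plus1 Suc_leI)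
  have eq: "k + 1 + j = k + (j + 1)" by simp
  have fact3: "(fact (3 * (k + 1) + j) :: real)
      = (real (3*k + j) + 2) * (real (3*k + j) + 3) * fact (3*k + (j + 1))"
  proof -
    have "3 * (k + 1) + j = Suc (Suc (3*k + (j + 1)))" by simp
    then show ?thesis by (simp only: fact_Suc) (simp add: ac_simps)
  qed
  have cancel: "(e * - 1) * (2 * a * s * f) * (u * v * h) * m / ((a * p)^5 * q) * (8 * a^4)
      = - (e * f * h * (m * 16) / (p^5 * (b * q))) * (s * u * v * b)"
    if "a \<noteq> 0" "b \<noteq> 0" for a b e f h m p q s u v :: real
    using that by (simp add: power_mult_distrib power_numeral_reduce)
  have "cubic_summand ((k + 1) + j) (k + 1) * (8 * (real k + 1)^4)
      = - cubic_summand (k + (j + 1)) k * ((2*real k + 1) * (real (3*k + j) + 2) * (real (3*k + j) + 3)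
           * (real j + 1))"
    unfolding cubic_summand_fact unfolding fact_double_Suc fact3 fact_Suc_real power_add power_one_right
    by (rule cancel) simp_all
  moreover have "real n = real k + real j + 1" using n by simp
  ultimately show ?thesis unfolding n eq by (simp add: algebra_simps)
qed

text \<open>The same elimination as for \<open>domb_summand\<close>: everything is expressed through
  one common factor \<open>Z\<close>. Here the denominators are positive, so no parity argument
  arises.\<close>

lemma domb_rec_cubic_summand:
  fixes n :: nat
  defines "G \<equiv> \<lambda>k. - 3 * (3*real n + 5) * real k^4 * cubic_summand (n + 2) k
                    / ((real n + 2*real k + 2) * (real n + 2*real k + 1))"
  assumes k: "k \<le> n + 2"
  shows "domb_rec (\<lambda>n. cubic_summand n k) n = G (k + 1) - G k"
proof -
  define x where "x = real k"
  define y where "y = real n"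
  define a where "a = y + 2*x + 2"
  define b where "b = y + 2*x + 1"
  have ab: "a \<noteq> 0" "b \<noteq> 0" "y + 2*x + 3 \<noteq> 0" "y + 2*x + 4 \<noteq> 0"
    by (simp_all add: a_def b_def x_def y_def add_nonneg_eq_0_iff)
  define Z where "Z = cubic_summand (n + 2) k / (256 * a * b)"
  have F2: "cubic_summand (n + 2) k = 256 * a * b * Z"
    using ab by (simp add: Z_def)
  have "cubic_summand (n + 1) k * (16 * a) = cubic_summand (n + 2) k * (y + 2 - x)"
    using cubic_summand_Suc_left[of k "n + 1"] k
    by (simp add: x_def y_def a_def add_ac algebra_simps)
  also have "\<dots> = (16 * b * (y + 2 - x) * Z) * (16 * a)"
    unfolding F2 by simp
  finally have F1: "cubic_summand (n + 1) k = 16 * b * (y + 2 - x) * Z"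
    using ab by simp
  have F0: "cubic_summand n k = (y + 1 - x) * (y + 2 - x) * Z"
  proof (cases "k \<le> n + 1")
    case True
    have "cubic_summand n k * (16 * b) = cubic_summand (n + 1) k * (y + 1 - x)"
      using cubic_summand_Suc_left[OF True] by (simp add: x_def y_def b_def algebra_simps)
    also have "\<dots> = ((y + 1 - x) * (y + 2 - x) * Z) * (16 * b)"
      unfolding F1 by simp
    finally show ?thesis using ab by simp
  next
    case False
    then have "k = n + 2" using k by simp
    then show ?thesis by (simp add: cubic_summand_eq_0 x_def y_def)
  qed
  have F2': "cubic_summand (n + 2) (k + 1) * (x + 1)^4
      = - 32 * (2*x + 1) * (y + 2*x + 3) * (y + 2*x + 4) * (y + 2 - x) * a * b * Z"
  proof -
    have "real (n + 2) + 2*real k + 1 = y + 2*x + 3" "real (n + 2) + 2*real k + 2 = y + 2*x + 4"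
      "real (n + 2) - real k = y + 2 - x" by (simp_all add: x_def y_def)
    then have "cubic_summand (n + 2) (k + 1) * (8 * (x + 1)^4)
        = - (256 * a * b * Z) * ((2*x + 1) * (y + 2*x + 3) * (y + 2*x + 4) * (y + 2 - x))"
      using cubic_summand_Suc_right[OF k] unfolding F2 x_def by (simp only:)
    then show ?thesis by algebra
  qed
  have "G (k + 1) = - 3 * (3*y + 5) * (cubic_summand (n + 2) (k + 1) * (x + 1)^4)
                      / ((y + 2*x + 4) * (y + 2*x + 3))"
    by (simp add: G_def x_def y_def algebra_simps)
  also have "\<dots> = 96 * (3*y + 5) * (2*x + 1) * (y + 2 - x) * a * b * Z"
    unfolding F2' using ab by (simp add: divide_simps) (simp add: algebra_simps)
  finally have G1: "G (k + 1) = 96 * (3*y + 5) * (2*x + 1) * (y + 2 - x) * a * b * Z" .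
  have "G k = - 3 * (3*y + 5) * x^4 * (256 * a * b * Z) / (a * b)"
    unfolding F2[symmetric] by (simp add: G_def x_def y_def a_def b_def)
  also have "\<dots> = - 768 * (3*y + 5) * x^4 * Z"
    using ab by (simp add: field_simps)
  finally have G0: "G k = - 768 * (3*y + 5) * x^4 * Z" .
  show ?thesis
    unfolding domb_rec_def F0 F1 F2 G0 G1 y_def[symmetric]
    unfolding a_def b_def by algebra
qed

lemma domb_rec_cubic_sum: "domb_rec (\<lambda>n. \<Sum>k\<le>n. cubic_summand n k) n = 0"
proof -
  define G where "G = (\<lambda>k. - 3 * (3*real n + 5) * real k^4 * cubic_summand (n + 2) k
                    / ((real n + 2*real k + 2) * (real n + 2*real k + 1)))"
  have ext: "(\<Sum>k\<le>m. cubic_summand m k) = (\<Sum>k\<le>n+2. cubic_summand m k)" if "m \<le> n + 2" for m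
    by (rule sum.mono_neutral_left) (use that in \<open>auto simp: cubic_summand_eq_0\<close>)
  have "domb_rec (\<lambda>n. \<Sum>k\<le>n. cubic_summand n k) n = domb_rec (\<lambda>m. \<Sum>k\<le>n+2. cubic_summand m k) n"
    by (intro domb_rec_cong ext) auto
  also have "\<dots> = (\<Sum>k<n+3. G (Suc k) - G k)"
    unfolding domb_rec_sum
  proof (rule sum.cong)
    show "domb_rec (\<lambda>m. cubic_summand m k) n = G (Suc k) - G k" if "k \<in> {..<n+3}" for k
      using domb_rec_cubic_summand[of k n] that by (simp add: G_def)
  qed auto
  also have "\<dots> = G (n + 3) - G 0"
    by (rule sum_lessThan_telescope)
  also have "\<dots> = 0"
    by (simp add: G_def cubic_summand_eq_0)
  finally show ?thesis .
qed

text \<open>Both sides satisfy the recurrence and take the values 1 and 4 at n = 0 and n = 1. This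
  is the cubic transformation on the level of coefficients.\<close>

lemma Domb_eq_cubic_sum: "real (Domb n) = (\<Sum>k\<le>n. cubic_summand n k)"
  by (rule domb_rec_eq_0_unique[OF domb_rec_Domb domb_rec_cubic_sum])
     (auto simp: Domb_def cubic_summand_def)

section \<open>The cubic transformation of the generating function\<close>

text \<open>The coefficients of the hypergeometric series 3F2(1/2, 1/3, 2/3; 1, 1; y).\<close>

definition cubic_coeff :: "nat \<Rightarrow> real" where
  "cubic_coeff k = pochhammer (1/2) k * pochhammer (1/3) k * pochhammer (2/3) k / fact k^3"

lemma cubic_coeff_Suc:
  "cubic_coeff (Suc k) = cubic_coeff k * ((real k + 1/2) * (real k + 1/3) * (real k + 2/3) / (real k + 1)^3)"
  by (simp add: cubic_coeff_def pochhammer_rec' power_mult_distrib add_ac mult_ac)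

lemma cubic_coeff_pos: "0 < cubic_coeff k"
  by (simp add: cubic_coeff_def pochhammer_pos)

lemma cubic_coeff_le_1: "cubic_coeff k \<le> 1"
proof (induction k)
  case (Suc k)
  have "(real k + 1/2) * (real k + 1/3) * (real k + 2/3) \<le> (real k + 1) * (real k + 1) * (real k + 1)"
    by (intro mult_mono) auto
  then have "(real k + 1/2) * (real k + 1/3) * (real k + 2/3) / (real k + 1)^3 \<le> 1"
    by (simp add: power3_eq_cube)
  then show ?case
    unfolding cubic_coeff_Suc using Suc cubic_coeff_pos[of k] by (intro mult_le_one) auto
qed (simp add: cubic_coeff_def)

text \<open>The product is (2k)! (3k)! / k!^5; comparing consecutive terms, the two factorials
  contribute 4 and 27, whose product is 108.\<close>

lemma binomials_eq_cubic_coeff: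
  "real (((2*k) choose k)^2 * ((3*k) choose k)) = 108^k * cubic_coeff k"
proof -
  have 1: "real ((2*k) choose k) = fact (2*k) / (fact k * fact k)"
    by (subst binomial_fact) (auto simp: mult_2)
  have 2: "real ((3*k) choose k) = fact (3*k) / (fact k * fact (2*k))"
    by (subst binomial_fact) auto
  have "real (((2*k) choose k)^2 * ((3*k) choose k)) = fact (2*k) * fact (3*k) / fact k^5"
    unfolding of_nat_mult of_nat_power 1 2 by (simp add: field_simps power_numeral_reduce)
  also have "\<dots> = 108^k * cubic_coeff k"
  proof (induction k)
    case (Suc k)
    have fact3: "(fact (3 * (k + 1)) :: real)
        = 3 * (real k + 1) * (3 * real k + 2) * (3 * real k + 1) * fact (3*k)"
    proof -
      have "3 * (k + 1) = Suc (Suc (Suc (3*k)))" by simp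
      then show ?thesis by (simp only: fact_Suc) (simp add: ac_simps)
    qed
    have cancel: "(2 * a * s * f) * (3 * a * u * v * h) / (a * p)^5
        = (f * h / p^5) * (108 * ((s / 2) * (v / 3) * (u / 3) / a^3))"
      if "a \<noteq> 0" for a f h p s u v :: real
      using that by (simp add: power_mult_distrib power_numeral_reduce mult_ac)
    have "fact (2 * (k + 1)) * fact (3 * (k + 1)) / fact (k + 1)^5
      = (fact (2*k) * fact (3*k) / fact k^5) *
        (108 * (((2 * real k + 1) / 2) * ((3 * real k + 1) / 3) * ((3 * real k + 2) / 3) / (real k + 1)^3))"
      unfolding fact_double_Suc fact3 fact_Suc_real by (rule cancel) simp
    then show ?case unfolding Suc cubic_coeff_Suc by (simp add: add_divide_distrib)
  qed (simp add: cubic_coeff_def)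
  finally show ?thesis .
qed

text \<open>Central binomials are bounded by powers of 4, and the squared binomials sum to a central
  binomial. The bound places -1/32 strictly inside the disc of convergence.\<close>

lemma Domb_le: "real (Domb n) \<le> 16^n"
proof -
  have "Domb n \<le> (\<Sum>k=0..n. (n choose k)^2 * 4^n)"
    unfolding Domb_def
  proof (rule sum_mono)
    fix k assume k: "k \<in> {0..n}"
    have "((2*k) choose k) * ((2*(n-k)) choose (n-k)) \<le> 2^(2*k) * 2^(2*(n-k))"
      by (intro mult_mono binomial_le_pow2) auto
    also have "\<dots> = (4::nat)^n"
      using k by (simp add: power_mult flip: power_add)
    finally show "(n choose k)^2 * ((2*k) choose k) * ((2*(n-k)) choose (n-k)) \<le> (n choose k)^2 * 4^n"
      by (simp add: mult.assoc)
  qed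
  also have "\<dots> = ((2*n) choose n) * 4^n"
    by (simp add: atLeast0AtMost choose_square_sum flip: sum_distrib_right)
  also have "\<dots> \<le> 2^(2*n) * 4^n"
    by (intro mult_mono binomial_le_pow2) auto
  also have "\<dots> = 16^n"
    by (simp add: power_mult flip: power_mult_distrib)
  finally show ?thesis
    by (metis of_nat_le_iff of_nat_numeral of_nat_power)
qed

text \<open>Newton's binomial series at exponent -(N + 1), with the upper index negated.\<close>

lemma binomial_neg_power_sums:
  fixes w :: complex
  assumes "norm w < 1"
  shows "(\<lambda>m. of_nat ((m + N) choose N) * w^m) sums (1 / (1 - w)^(N + 1))"
proof -
  have "((- of_nat (N + 1)) gchoose m) * (- w)^m = of_nat ((m + N) choose N) * w^m" for m
  proof -
    have "((- of_nat (N + 1)) gchoose m) = (-1)^m * ((of_nat (m + N) :: complex) gchoose m)"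
      by (subst gbinomial_minus) (simp add: add_ac)
    also have "(of_nat (m + N) :: complex) gchoose m = of_nat ((m + N) choose N)"
      using binomial_symmetric[of m "m + N"] by (simp flip: binomial_gbinomial of_nat_add)
    finally show ?thesis by (simp add: power_minus[of w])
  qed
  moreover have "(1 + - w) powr (- of_nat (N + 1)) = 1 / (1 - w)^(N + 1)"
  proof -
    have "1 - w \<noteq> 0" using assms by auto
    then show ?thesis by (simp add: powr_minus powr_nat' inverse_eq_divide del: of_nat_Suc power_Suc of_nat_add)
  qed
  ultimately show ?thesis
    using gen_binomial_complex[of "- w" "- of_nat (N + 1)"] assms by simp
qed

text \<open>Used with w = 16 z for the rows of the double series, where n = k + m and the weight is
  1 + 3n. The operator 1 + 3 t d/dt thus acts on coefficients and no function is differentiated. The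
  factor 1 + 2w becomes 1 + 32 z, the zero at the critical point.\<close>

lemma weighted_binomial_sums:
  fixes w :: complex
  assumes "norm w < 1"
  shows "(\<lambda>m. of_nat ((1 + 3*k + 3*m) * ((m + 3*k) choose (3*k))) * w^m)
           sums (of_nat (3*k + 1) * (1 + 2*w) / (1 - w)^(3*k + 2))"
proof -
  \<comment> \<open>The weight is absorbed by raising the lower index of the binomial, via m
    \<open>C\<close> = (3k + 1) \<open>C'\<close>.\<close>
  have eq: "(1 + 3*k + 3*m) * ((m + 3*k) choose (3*k))
      = (3*k + 1) * (((m + (3*k + 1)) choose (3*k + 1)) + 2 * ((m + 3*k) choose (3*k + 1)))" for m
  proof -
    define C where "C = (m + 3*k) choose (3*k)"
    define C' where "C' = (m + 3*k) choose (3*k + 1)"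
    have s: "(m + (3*k + 1)) choose (3*k + 1) = C + C'"
      by (simp add: C_def C'_def)
    have "Suc (m + 3*k) * C = (C + C') * Suc (3*k)"
      unfolding C_def Suc_times_binomial_eq s[unfolded C_def, symmetric] by simp
    then have "m * C = (3*k + 1) * C'" by (simp add: algebra_simps)
    then show ?thesis unfolding s C_def[symmetric] C'_def[symmetric] by (simp add: algebra_simps)
  qed
  define L where "L = 1 / (1 - w)^(3*k + 1 + 1)"
  have 1: "(\<lambda>m. of_nat ((m + (3*k + 1)) choose (3*k + 1)) * w^m) sums L"
    unfolding L_def by (rule binomial_neg_power_sums[OF assms])
  have "(\<lambda>m. of_nat ((Suc m + 3*k) choose (3*k + 1)) * w^Suc m) sums (w * L)"
    using sums_mult[OF 1, of w] by (simp add: mult_ac)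
  \<comment> \<open>The term at m = 0 is 0, so the index shift loses nothing.\<close>
  then have 2: "(\<lambda>m. of_nat ((m + 3*k) choose (3*k + 1)) * w^m) sums (w * L)"
    by (subst (asm) sums_Suc_iff) (simp add: binomial_eq_0)
  have "(\<lambda>m. of_nat (3*k + 1) * (of_nat ((m + (3*k + 1)) choose (3*k + 1)) * w^m
           + 2 * (of_nat ((m + 3*k) choose (3*k + 1)) * w^m)))
         sums (of_nat (3*k + 1) * (L + 2 * (w * L)))"
    by (intro sums_mult sums_add 1 2)
  then show ?thesis
    unfolding eq by (simp add: L_def algebra_simps add_divide_distrib)
qed

section \<open>Convergence of the two weighted power series\<close>

lemma domb_series_summable:
  fixes z :: complex
  assumes "norm z < 1/16"
  shows "summable (\<lambda>n. of_real ((1 + 3*real n) * real (Domb n)) * z^n)"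
proof (rule summable_comparison_test')
  have "summable (\<lambda>n. of_nat (Suc n) * (16 * norm z)^n)"
    using geometric_deriv_sums[of "16 * norm z"] assms by (auto simp: sums_iff)
  then show "summable (\<lambda>n. 3 * (real (Suc n) * (16 * norm z)^n))"
    by (intro summable_mult) simp
  fix n
  have "norm (of_real ((1 + 3*real n) * real (Domb n)) * z^n) = (1 + 3*real n) * real (Domb n) * norm z^n"
    by (simp only: norm_mult norm_power norm_of_real) simp
  also have "\<dots> \<le> (3 * real (Suc n)) * 16^n * norm z^n"
    by (intro mult_mono Domb_le) auto
  also have "\<dots> = 3 * (real (Suc n) * (16 * norm z)^n)"
    by (simp add: power_mult_distrib)
  finally show "norm (of_real ((1 + 3*real n) * real (Domb n)) * z^n) \<le> 3 * (real (Suc n) * (16 * norm z)^n)" .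
qed

lemma cubic_series_summable:
  fixes y :: complex
  assumes "norm y < 1"
  shows "summable (\<lambda>k. of_real ((1 + 3*real k) * cubic_coeff k) * y^k)"
proof (rule summable_comparison_test')
  have "summable (\<lambda>n. of_nat (Suc n) * (norm y)^n)"
    using geometric_deriv_sums[of "norm y"] assms by (auto simp: sums_iff)
  then show "summable (\<lambda>n. 3 * (real (Suc n) * (norm y)^n))"
    by (intro summable_mult) simp
  fix n
  have "norm (of_real ((1 + 3*real n) * cubic_coeff n) * y^n) = (1 + 3*real n) * cubic_coeff n * norm y^n"
    using cubic_coeff_pos[of n]
    by (simp only: norm_mult norm_power norm_of_real) (simp add: abs_mult)
  also have "\<dots> \<le> (3 * real (Suc n)) * 1 * norm y^n"
    using cubic_coeff_pos[of n] by (intro mult_mono cubic_coeff_le_1) auto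
  also have "\<dots> = 3 * (real (Suc n) * (norm y)^n)"
    by simp
  finally show "norm (of_real ((1 + 3*real n) * cubic_coeff n) * y^n) \<le> 3 * (real (Suc n) * (norm y)^n)" .
qed

lemma cubic_argument_small:
  fixes z :: complex
  assumes "norm z < 1/8192"
  shows "108 * norm z < norm (1 - 16*z)^3"
proof -
  have "1/2 \<le> norm (1 - 16*z)"
    using norm_triangle_ineq2[of 1 "16*z"] assms by (simp add: norm_mult)
  then have "(1/2)^3 \<le> norm (1 - 16*z)^3" by (intro power_mono) auto
  then show ?thesis using assms by (simp add: power3_eq_cube)
qed

text \<open>One double series summed in two ways: the rows (fixed k) give the right-hand side by the
  negative binomial series, the antidiagonals k + m = n give the left-hand side by
  \<open>Domb_eq_cubic_sum\<close>. For such small z absolute convergence justifies the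
  exchange.\<close>

lemma domb_series_transform_near_0:
  fixes z :: complex
  assumes z: "norm z < 1/8192"
  shows "(\<Sum>n. of_real ((1 + 3*real n) * real (Domb n)) * z^n)
       = (1 + 32*z) / (1 - 16*z)^2
           * (\<Sum>k. of_real ((1 + 3*real k) * cubic_coeff k) * (- 108*z / (1 - 16*z)^3)^k)"
proof -
  define c where "c = (\<lambda>k. ((2*k) choose k)^2 * ((3*k) choose k))"
  define g where "g = (\<lambda>(k, m). (of_nat (c k) * (- z)^k) *
      (of_nat ((1 + 3*k + 3*m) * ((m + 3*k) choose (3*k))) * (16*z)^m))"
  have w: "norm (16*z) < 1" using z by (simp add: norm_mult)
  \<comment> \<open>The weight is at most 4^(k+m) by Bernoulli and the binomial at most 2^(m+3k).
    The ratios are therefore 108 * 4 * 8 = 3456 and 4 * 2 * 16 = 128 times |z|, both at most 1/2 for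
    |z| < 1/8192.\<close>
  have bound: "norm (g (k, m)) \<le> (1/2)^k * (1/2)^m" for k m
  proof -
    have "norm (g (k, m)) = real (c k) * norm z^k *
        (real ((1 + 3*k + 3*m) * ((m + 3*k) choose (3*k))) * (16*norm z)^m)"
      by (simp only: g_def prod.case norm_mult norm_power norm_of_nat norm_minus_cancel norm_numeral)
    also have "\<dots> \<le> 108^k * norm z^k * (real (4^(k + m) * 2^(m + 3*k)) * (16*norm z)^m)"
    proof (intro mult_mono of_nat_mono binomial_le_pow2)
      show "real (c k) \<le> 108^k"
        unfolding c_def binomials_eq_cubic_coeff using cubic_coeff_le_1[of k] by simp
      have "1 + 3 * real (k + m) \<le> (1 + 3)^(k + m)"
        using Bernoulli_inequality[of 3 "k + m"] by (simp add: mult.commute)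
      then have "real (1 + 3*k + 3*m) \<le> real (4^(k + m))" by simp
      then show "1 + 3*k + 3*m \<le> 4^(k + m)" by (simp only: of_nat_le_iff)
    qed auto
    also have "\<dots> = (3456 * norm z)^k * (128 * norm z)^m"
    proof -
      have "(2::real)^(m + 3*k) = 2^m * 8^k" by (simp add: power_add power_mult)
      moreover have "(3456::real)^k = 108^k * 4^k * 8^k" "(128::real)^m = 4^m * 2^m * 16^m"
        by (simp_all flip: power_mult_distrib)
      ultimately show ?thesis by (simp add: power_add power_mult_distrib)
    qed
    also have "\<dots> \<le> (1/2)^k * (1/2)^m"
      using z by (intro mult_mono power_mono) auto
    finally show ?thesis .
  qed
  have half: "(\<lambda>n. (1/2::real)^n) summable_on UNIV"
    by (rule norm_summable_imp_summable_on) (simp add: summable_geometric)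
  have "(\<lambda>p. norm (case p of (k, m) \<Rightarrow> (1/2::real)^k * (1/2)^m)) summable_on (UNIV \<times> UNIV)"
  proof (rule Infinite_Sum.abs_summable_on_Sigma_iff[THEN iffD2], intro conjI ballI)
    show "(\<lambda>m. norm (case (k, m) of (k, m) \<Rightarrow> (1/2::real)^k * (1/2)^m)) summable_on UNIV" for k :: nat
      using summable_on_cmult_right[OF half, of "(1/2)^k"] by (simp add: abs_mult)
    have "(\<lambda>k. (1/2::real)^k * infsum (\<lambda>m. (1/2)^m) (UNIV :: nat set)) summable_on UNIV"
      by (rule summable_on_cmult_left[OF half])
    then show "(\<lambda>k. norm (infsum (\<lambda>m. norm (case (k, m) of (k, m) \<Rightarrow> (1/2::real)^k * (1/2)^m)) UNIV)) summable_on UNIV"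
      by (simp add: abs_mult infsum_cmult_right' infsum_nonneg)
  qed
  then have "(\<lambda>p. norm (g p)) summable_on (UNIV \<times> UNIV)"
    by (rule Infinite_Sum.abs_summable_on_comparison_test) (use bound in auto)
  then obtain T where T: "(g has_sum T) (UNIV \<times> UNIV)"
    using abs_summable_summable summable_on_def by blast
  have row_abs: "summable (\<lambda>m. norm (g (k, m)))" for k
    by (rule summable_comparison_test'[OF summable_mult[OF summable_geometric[of "1/2::real"], of "(1/2)^k"]])
       (use bound in auto)

  define row where "row = (\<lambda>k. (of_nat (c k) * (- z)^k) *
      (of_nat (3*k + 1) * (1 + 2*(16*z)) / (1 - 16*z)^(3*k + 2)))"
  have "(\<lambda>m. g (k, m)) sums row k" for k
    unfolding g_def row_def prod.case by (intro sums_mult weighted_binomial_sums[OF w])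
  then have "((\<lambda>m. g (k, m)) has_sum row k) UNIV" for k
    by (intro norm_summable_imp_has_sum row_abs)
  then have "(row has_sum T) UNIV"
    by (intro has_sum_SigmaD[OF T]) auto
  then have row: "row sums T" by (rule has_sum_imp_sums)

  \<comment> \<open>Regrouping of the pairs (k, m) along the antidiagonals n = k + m.\<close>
  have "bij_betw (\<lambda>(n, k). (k, n - k)) (SIGMA n:UNIV. {..n::nat}) (UNIV \<times> UNIV)"
    by (rule bij_betwI[where g = "\<lambda>(k, m). (k + m, k)"]) auto
  from has_sum_reindex_bij_betw[OF this, of g T] T
  have "((\<lambda>x. g (case x of (n, k) \<Rightarrow> (k, n - k))) has_sum T) (SIGMA n:UNIV. {..n})"
    by simp
  then have "((\<lambda>n. \<Sum>k\<le>n. g (k, n - k)) has_sum T) UNIV"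
    by (rule has_sum_SigmaD) (auto intro: has_sum_finiteI)
  then have diag: "(\<lambda>n. \<Sum>k\<le>n. g (k, n - k)) sums T" by (rule has_sum_imp_sums)

  have "(\<Sum>k\<le>n. g (k, n - k)) = of_real ((1 + 3*real n) * real (Domb n)) * z^n" for n
  proof -
    have "g (k, n - k) = of_real ((1 + 3*real n) * cubic_summand n k) * z^n" if k: "k \<le> n" for k
    proof -
      obtain j where n: "n = k + j" using k le_Suc_ex by blast
      show ?thesis
        unfolding n g_def cubic_summand_def c_def
        by (simp add: power_add power_mult_distrib power_minus[of z])
          (simp add: ring_distribs add.commute[of "3*k" j])
    qed
    then show ?thesis
      by (simp add: Domb_eq_cubic_sum sum_distrib_left sum_distrib_right)
  qed
  with diag have S: "(\<lambda>n. of_real ((1 + 3*real n) * real (Domb n)) * z^n) sums T" by simp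

  have nz: "1 - 16*z \<noteq> 0" using w by (metis norm_one order_less_irrefl right_minus_eq)
  have row_eq: "row k = (1 + 32*z) / (1 - 16*z)^2
           * (of_real ((1 + 3*real k) * cubic_coeff k) * (- 108*z / (1 - 16*z)^3)^k)" for k
  proof -
    have "of_nat (c k) = complex_of_real (real (c k))" by simp
    also have "\<dots> = of_real (108^k * cubic_coeff k)"
      unfolding c_def binomials_eq_cubic_coeff ..
    finally have ck: "of_nat (c k) = (108^k * complex_of_real (cubic_coeff k))" by simp
    have p: "(- 108*z / (1 - 16*z)^3)^k = 108^k * (- z)^k / (1 - 16*z)^(3*k)"
    proof -
      have "- 108*z / (1 - 16*z)^3 = 108 * (- z) / (1 - 16*z)^3" by simp
      then show ?thesis by (simp only: power_divide power_mult_distrib power_mult)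
    qed
    show ?thesis
      unfolding row_def ck p by (simp add: power_add power2_eq_square field_simps)
  qed
  have row': "(\<lambda>k. (1 + 32*z) / (1 - 16*z)^2
           * (of_real ((1 + 3*real k) * cubic_coeff k) * (- 108*z / (1 - 16*z)^3)^k)) sums T"
    by (rule sums_cong[THEN iffD1, OF row_eq row])
  have "norm (- 108*z / (1 - 16*z)^3) < 1"
  proof -
    have "108 * norm z < norm (1 - 16*z)^3" by (rule cubic_argument_small[OF z])
    moreover have "0 < norm (1 - 16*z)^3" using nz by simp
    ultimately show ?thesis by (simp add: norm_divide norm_mult norm_power)
  qed
  from sums_mult[OF summable_sums[OF cubic_series_summable[OF this]], of "(1 + 32*z) / (1 - 16*z)^2"]
  show ?thesis
    by (rule trans[OF sums_unique[OF S, symmetric] sums_unique2[OF row']])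
qed

text \<open>The double series is not absolutely convergent up to \<open>z = - 1/32\<close>, hence the analytic
  continuation along the segment.\<close>

lemma domb_series_transform:
  fixes t :: real
  assumes t: "0 \<le> t" "t < 1/32"
  defines "z \<equiv> - complex_of_real t"
  shows "(\<Sum>n. of_real ((1 + 3*real n) * real (Domb n)) * z^n)
       = (1 + 32*z) / (1 - 16*z)^2
           * (\<Sum>k. of_real ((1 + 3*real k) * cubic_coeff k) * (- 108*z / (1 - 16*z)^3)^k)"
proof -
  \<comment> \<open>The first condition makes the Domb series converge, the second puts the argument
    of the hypergeometric series into the unit disc.\<close>
  define U where "U = {z::complex. norm z < 1/16 \<and> 108 * norm z < norm (1 - 16*z)^3}"
  define E where "E = (\<lambda>z::complex. \<Sum>n. of_real ((1 + 3*real n) * real (Domb n)) * z^n)"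
  define H where "H = (\<lambda>y::complex. \<Sum>k. of_real ((1 + 3*real k) * cubic_coeff k) * y^k)"
  \<comment> \<open>The component of 0 supplies the connected domain for the identity theorem; it
    remains to show that it contains the segment.\<close>
  define K where "K = connected_component_set U 0"
  have nz: "1 - 16*z \<noteq> 0" if "z \<in> U" for z
    using that by (auto simp: U_def)
  have "open U"
    unfolding U_def by (intro open_Collect_conj open_Collect_less continuous_intros)
  then have K: "open K" "connected K" "K \<subseteq> U"
    by (auto simp: K_def open_connected_component connected_component_subset)
  have near0: "ball 0 (1/8192) \<subseteq> K"
    unfolding K_def using cubic_argument_small
    by (intro connected_component_maximal) (auto simp: U_def)
  have "E holomorphic_on ball 0 (1/16)"
    by (rule power_series_holomorphic[where a = "\<lambda>n. of_real ((1 + 3*real n) * real (Domb n))"])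
       (simp add: E_def summable_sums domb_series_summable del: of_real_mult)
  then have E: "E holomorphic_on K"
    by (rule holomorphic_on_subset) (use K(3) in \<open>auto simp: U_def\<close>)
  have H: "H holomorphic_on ball 0 1"
    by (rule power_series_holomorphic[where a = "\<lambda>k. of_real ((1 + 3*real k) * cubic_coeff k)"])
       (simp add: H_def summable_sums cubic_series_summable del: of_real_mult)
  have "(\<lambda>z. H (- 108*z / (1 - 16*z)^3)) holomorphic_on U"
  proof (rule holomorphic_on_compose_gen[OF _ H, unfolded o_def])
    show "(\<lambda>z. - 108*z / (1 - 16*z)^3) holomorphic_on U"
      by (intro holomorphic_intros) (use nz in auto)
    show "(\<lambda>z. - 108*z / (1 - 16*z)^3) ` U \<subseteq> ball 0 1"
      using nz by (auto simp: U_def norm_divide norm_mult norm_power)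
  qed
  then have "(\<lambda>z. (1 + 32*z) / (1 - 16*z)^2 * H (- 108*z / (1 - 16*z)^3)) holomorphic_on U"
    by (intro holomorphic_intros) (use nz in auto)
  then have G: "(\<lambda>z. (1 + 32*z) / (1 - 16*z)^2 * H (- 108*z / (1 - 16*z)^3)) holomorphic_on K"
    using K(3) by (rule holomorphic_on_subset)
  have "z \<in> K"
  proof -
    define I where "I = (\<lambda>t. - complex_of_real t) ` {0..<1/32}"
    have "connected I"
      unfolding I_def by (intro connected_continuous_image continuous_intros) auto
    moreover have "0 \<in> I" by (force simp: I_def)
    moreover have "I \<subseteq> U"
    proof
      fix w assume "w \<in> I"
      then obtain r where r: "0 \<le> r" "r < 1/32" "w = - complex_of_real r" by (auto simp: I_def)
      \<comment> \<open>The double root r = 1/32 is where the argument reaches 1, so the half-open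
        segment stays inside \<open>U\<close>.\<close>
      have "(1 + 16*r)^3 - 108*r = (1 - 32*r)^2 * (1 + 4*r)" by algebra
      moreover have "(1 - 32*r)^2 * (1 + 4*r) > 0" using r by (intro mult_pos_pos) auto
      ultimately have "108*r < (1 + 16*r)^3" by linarith
      moreover have "norm (1 - 16*w) = 1 + 16*r"
      proof -
        have "1 - 16*w = complex_of_real (1 + 16*r)" using r by simp
        then show ?thesis using r by (simp only: norm_of_real)
      qed
      ultimately show "w \<in> U" using r by (simp add: U_def)
    qed
    ultimately have "I \<subseteq> K" unfolding K_def by (intro connected_component_maximal)
    then show ?thesis using t by (auto simp: I_def z_def)
  qed
  have "E z = (1 + 32*z) / (1 - 16*z)^2 * H (- 108*z / (1 - 16*z)^3)"
  proof (rule analytic_continuation_open[OF _ K(1) _ K(2) near0 E G _ \<open>z \<in> K\<close>])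
    show "E z = (1 + 32*z) / (1 - 16*z)^2 * H (- 108*z / (1 - 16*z)^3)" if "z \<in> ball 0 (1/8192)" for z
      unfolding E_def H_def using that by (intro domb_series_transform_near_0) simp
  qed auto
  then show ?thesis by (simp only: E_def H_def)
qed

section \<open>Restriction of the transformation to real arguments\<close>

lemma domb_series_summable_real:
  assumes "\<bar>x\<bar> < 1/16"
  shows "summable (\<lambda>n. (1 + 3*real n) * real (Domb n) * x^n)"
proof -
  have "summable (\<lambda>n. complex_of_real ((1 + 3*real n) * real (Domb n) * x^n))"
    using domb_series_summable[of "of_real x"] assms by simp
  then show ?thesis by (simp only: summable_complex_of_real)
qed

lemma cubic_series_summable_real:
  assumes "\<bar>y\<bar> < 1"
  shows "summable (\<lambda>k. (1 + 3*real k) * cubic_coeff k * y^k)"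
proof -
  have "summable (\<lambda>k. complex_of_real ((1 + 3*real k) * cubic_coeff k * y^k))"
    using cubic_series_summable[of "of_real y"] assms by simp
  then show ?thesis by (simp only: summable_complex_of_real)
qed

text \<open>The double root makes sqrt (1 - y) equal to 1 - 32 t up to a positive smooth factor,
  which is what cancels the zero of the prefactor.\<close>

lemma one_minus_cubic_argument:
  fixes t :: real
  assumes "0 \<le> t"
  shows "1 - 108*t / (1 + 16*t)^3 = (1 - 32*t)^2 * (1 + 4*t) / (1 + 16*t)^3"
proof -
  have "(1 + 16*t)^3 - 108*t = (1 - 32*t)^2 * (1 + 4*t)" by algebra
  moreover have "1 + 16*t \<noteq> 0" using assms by simp
  ultimately show ?thesis by (simp add: divide_simps)
qed

lemma cubic_argument_less_1:
  fixes t :: real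
  assumes "0 \<le> t" "t < 1/32"
  shows "108*t / (1 + 16*t)^3 < 1"
proof -
  have "0 < (1 - 32*t)^2 * (1 + 4*t) / (1 + 16*t)^3" using assms by simp
  then show ?thesis
    using one_minus_cubic_argument[of t] assms by linarith
qed

lemma domb_series_transform_real:
  fixes t :: real
  assumes t: "0 \<le> t" "t < 1/32"
  shows "(\<Sum>n. (1 + 3*real n) * real (Domb n) * (- t)^n)
       = (1 - 32*t) / (1 + 16*t)^2
           * (\<Sum>k. (1 + 3*real k) * cubic_coeff k * (108*t / (1 + 16*t)^3)^k)"
proof -
  have 1: "complex_of_real (\<Sum>n. (1 + 3*real n) * real (Domb n) * (- t)^n)
      = (\<Sum>n. of_real ((1 + 3*real n) * real (Domb n)) * (- complex_of_real t)^n)"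
    by (subst suminf_of_real) (use t in \<open>auto intro!: domb_series_summable_real\<close>)
  have 2: "complex_of_real (\<Sum>k. (1 + 3*real k) * cubic_coeff k * (108*t / (1 + 16*t)^3)^k)
      = (\<Sum>k. of_real ((1 + 3*real k) * cubic_coeff k) * (- 108*(- complex_of_real t) / (1 - 16*(- complex_of_real t))^3)^k)"
    by (subst suminf_of_real) (use t cubic_argument_less_1[OF t] in \<open>auto intro!: cubic_series_summable_real\<close>)
  have "complex_of_real (\<Sum>n. (1 + 3*real n) * real (Domb n) * (- t)^n)
       = of_real ((1 - 32*t) / (1 + 16*t)^2
           * (\<Sum>k. (1 + 3*real k) * cubic_coeff k * (108*t / (1 + 16*t)^3)^k))"
    unfolding 1 of_real_mult 2[unfolded of_real_mult] using domb_series_transform[OF t] by simp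
  then show ?thesis by (simp only: of_real_eq_iff)
qed

section \<open>Behaviour at the critical point\<close>

text \<open>An Abelian comparison: beyond some index a - L b is at most e/2 times b, and the
  finitely many earlier terms are negligible because the denominator series diverges at 1.\<close>

lemma powser_ratio_tendsto_at_left_1:
  fixes a b :: "nat \<Rightarrow> real"
  assumes b: "\<And>n. 0 < b n"
    and lim: "(\<lambda>n. a n / b n) \<longlonglongrightarrow> L"
    and summ: "\<And>y. 0 \<le> y \<Longrightarrow> y < 1 \<Longrightarrow> summable (\<lambda>n. b n * y^n)"
    and div: "filterlim (\<lambda>y. \<Sum>n. b n * y^n) at_top (at_left 1)"
  shows "((\<lambda>y. (\<Sum>n. a n * y^n) / (\<Sum>n. b n * y^n)) \<longlongrightarrow> L) (at_left 1)"
proof (rule tendstoI)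
  fix e :: real assume e: "e > 0"
  define d where "d = (\<lambda>n. a n - L * b n)"
  obtain N where N: "\<And>n. n \<ge> N \<Longrightarrow> \<bar>a n / b n - L\<bar> < e / 2"
    using LIMSEQ_D[OF lim, of "e/2"] e by auto
  have tail: "\<bar>d n\<bar> \<le> e / 2 * b n" if "n \<ge> N" for n
  proof -
    have "d n = (a n / b n - L) * b n" using b[of n] by (simp add: d_def field_simps)
    then have "\<bar>d n\<bar> = \<bar>a n / b n - L\<bar> * b n" using b[of n] by (simp add: abs_mult)
    also have "\<dots> \<le> e / 2 * b n" using N[OF that] b[of n] by (intro mult_right_mono) auto
    finally show ?thesis .
  qed
  define S where "S = (\<Sum>n<N. \<bar>d n\<bar>)"
  define B where "B = (\<lambda>y. \<Sum>n. b n * y^n)"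
  \<comment> \<open>This threshold gives S < e/2 * \<open>B y\<close>, so the initial terms use up
    at most half of the error.\<close>
  have "eventually (\<lambda>y. B y > 2 * S / e + 1) (at_left 1)"
    using div unfolding B_def filterlim_at_top_dense by blast
  moreover have "eventually (\<lambda>y::real. y \<in> {0<..<1}) (at_left 1)"
    by (rule eventually_at_leftI[of 0]) auto
  ultimately show "eventually (\<lambda>y. dist ((\<Sum>n. a n * y^n) / (\<Sum>n. b n * y^n)) L < e) (at_left 1)"
  proof eventually_elim
    case (elim y)
    then have y: "0 \<le> y" "y < 1" by auto
    have Bs: "(\<lambda>n. b n * y^n) sums B y"
      unfolding B_def by (rule summable_sums[OF summ[OF y]])
    \<comment> \<open>A single majorant: \<open>u\<close> covers the initial terms, as y^n <= 1, and
      e/2 times the b-series covers the tail. It yields both summability and the estimate.\<close>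
    define u where "u = (\<lambda>n. if n < N then \<bar>d n\<bar> else 0)"
    have "u sums S"
      using sums_If_finite[of "\<lambda>n. n < N" "\<lambda>n. \<bar>d n\<bar>"] by (simp add: u_def S_def lessThan_def)
    then have dom: "(\<lambda>n. u n + e / 2 * (b n * y^n)) sums (S + e / 2 * B y)"
      by (intro sums_add sums_mult Bs)
    have le: "\<bar>d n * y^n\<bar> \<le> u n + e / 2 * (b n * y^n)" for n
    proof (cases "n < N")
      case True
      have "\<bar>d n * y^n\<bar> \<le> \<bar>d n\<bar> * 1"
        using y power_le_one[of y n] by (simp add: abs_mult mult_left_le)
      moreover have "0 \<le> e / 2 * (b n * y^n)" using e b[of n] y by simp
      ultimately show ?thesis using True by (simp add: u_def)
    next
      case False
      have "\<bar>d n * y^n\<bar> = \<bar>d n\<bar> * y^n" using y by (simp add: abs_mult)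
      also have "\<dots> \<le> (e / 2 * b n) * y^n" using tail[of n] False y by (intro mult_right_mono) auto
      finally show ?thesis using False by (simp add: u_def mult_ac)
    qed
    have sd: "summable (\<lambda>n. \<bar>d n * y^n\<bar>)"
      by (rule summable_comparison_test'[OF sums_summable[OF dom]]) (use le in auto)
    then have sd': "summable (\<lambda>n. d n * y^n)" by (rule summable_rabs_cancel)
    have "\<bar>\<Sum>n. d n * y^n\<bar> \<le> (\<Sum>n. \<bar>d n * y^n\<bar>)" by (rule summable_rabs[OF sd])
    also have "\<dots> \<le> S + e / 2 * B y"
      unfolding sums_unique[OF dom] by (rule suminf_le[OF le sd sums_summable[OF dom]])
    finally have D: "\<bar>\<Sum>n. d n * y^n\<bar> \<le> S + e / 2 * B y" .
    have "(\<lambda>n. d n * y^n + L * (b n * y^n)) sums ((\<Sum>n. d n * y^n) + L * B y)"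
      by (intro sums_add sums_mult Bs summable_sums sd')
    then have A: "(\<Sum>n. a n * y^n) = (\<Sum>n. d n * y^n) + L * B y"
      by (simp add: d_def algebra_simps sums_iff)
    have "S \<ge> 0" by (simp add: S_def sum_nonneg)
    then have "0 \<le> 2 * S / e" using e by simp
    then have B0: "B y > 0" using elim by linarith
    have "S < e / 2 * B y" using elim e by (simp add: field_simps)
    then have "\<bar>\<Sum>n. d n * y^n\<bar> < e * B y" using D by simp
    moreover have "(\<Sum>n. a n * y^n) / B y - L = (\<Sum>n. d n * y^n) / B y"
      using B0 by (simp add: A field_simps)
    ultimately have "\<bar>(\<Sum>n. a n * y^n) / B y - L\<bar> < e"
      using B0 by (simp add: abs_divide divide_less_eq)
    then show ?case by (simp only: dist_real_def B_def)
  qed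
qed

text \<open>Newton's series at exponent -1/2; it is the comparison series with an explicit
  singularity at 1.\<close>

lemma inverse_sqrt_sums:
  fixes y :: real
  assumes "\<bar>y\<bar> < 1"
  shows "(\<lambda>n. pochhammer (1/2) n / fact n * y^n) sums (1 / sqrt (1 - y))"
proof -
  have "((- 1/2) gchoose n) * (- y)^n = pochhammer (1/2) n / fact n * y^n" for n
    by (simp add: gbinomial_pochhammer power_minus[of y])
  moreover have "(1 + - y) powr (- 1/2) = 1 / sqrt (1 - y)"
    using assms powr_minus[of "1 - y" "1/2"] by (simp add: powr_half_sqrt inverse_eq_divide)
  ultimately show ?thesis
    using gen_binomial_real[of "- y" "- 1/2"] assms by simp
qed

text \<open>Euler's reflection formula with sin (pi/3) = sqrt 3 / 2, transferred from the complex
  reciprocal Gamma function.\<close>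

lemma rGamma_third_reflection: "rGamma (1/3) * rGamma (2/3 :: real) = sqrt 3 / (2 * pi)"
proof -
  have "rGamma (complex_of_real (1/3)) * rGamma (complex_of_real (2/3))
      = sin (complex_of_real (pi * (1/3))) / complex_of_real pi"
    using rGamma_reflection_complex[of "1/3"] by simp
  then have "complex_of_real (rGamma (1/3) * rGamma (2/3)) = complex_of_real (sin (pi * (1/3)) / pi)"
    by (simp only: rGamma_complex_of_real sin_of_real flip: of_real_mult of_real_divide)
  then have "rGamma (1/3) * rGamma (2/3) = sin (pi * (1/3)) / pi"
    by (simp only: of_real_eq_iff)
  then show ?thesis by (simp add: sin_60)
qed

lemma cubic_coeff_ratio_tendsto:
  "(\<lambda>k. (1 + 3*real k) * cubic_coeff k / (pochhammer (1/2) k / fact k)) \<longlonglongrightarrow> 3 * sqrt 3 / (2 * pi)"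
proof -
  \<comment> \<open>The powers n^(1/3) and n^(2/3) in Euler's limit for 1/Gamma multiply to n. The
    factor 3n / (n + 2/3) removes this n, turns the extra factor n + 1/3 into 1 + 3n and cancels n +
    2/3, so the terms agree exactly for n > 0.\<close>
  have "(\<lambda>n. rGamma_series (1/3) n * rGamma_series (2/3) n * (3 * (real n / (real n + 2/3))))
      \<longlonglongrightarrow> rGamma (1/3) * rGamma (2/3) * (3 * 1)"
    by (intro tendsto_mult rGamma_series_LIMSEQ tendsto_const) real_asymp
  then have "(\<lambda>n. rGamma_series (1/3) n * rGamma_series (2/3) n * (3 * (real n / (real n + 2/3))))
      \<longlonglongrightarrow> 3 * sqrt 3 / (2 * pi)"
    by (simp add: rGamma_third_reflection mult_ac)
  moreover have "eventually (\<lambda>n. rGamma_series (1/3) n * rGamma_series (2/3) n * (3 * (real n / (real n + 2/3)))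
      = (1 + 3*real n) * cubic_coeff n / (pochhammer (1/2) n / fact n)) sequentially"
    using eventually_gt_at_top[of 0]
  proof eventually_elim
    case (elim n)
    have "exp (1/3 * ln (real n)) * exp (2/3 * ln (real n)) = real n"
      using elim by (simp flip: exp_add)
    then have "rGamma_series (1/3) n * rGamma_series (2/3) n
        = pochhammer (1/3) (n + 1) * pochhammer (2/3) (n + 1) / (fact n^2 * real n)"
      by (simp add: rGamma_series_def power2_eq_square mult_ac)
    moreover have "pochhammer (1/2) n \<noteq> (0::real)"
      using pochhammer_pos[of "1/2::real" n] by simp
    ultimately show ?case
      using elim by (simp add: cubic_coeff_def pochhammer_rec' divide_simps)
        (simp add: algebra_simps power2_eq_square power3_eq_cube)
  qed
  ultimately show ?thesis
    by (rule Lim_transform_eventually)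
qed

text \<open>Comparison with the series of (1 - y)^(-1/2), using the limit of the coefficient
  ratios.\<close>

lemma cubic_series_asymp_at_left_1:
  "((\<lambda>y. (\<Sum>k. (1 + 3*real k) * cubic_coeff k * y^k) * sqrt (1 - y)) \<longlongrightarrow> 3 * sqrt 3 / (2 * pi))
     (at_left 1)"
proof -
  have ev: "eventually (\<lambda>y::real. (\<Sum>n. pochhammer (1/2) n / fact n * y^n) = 1 / sqrt (1 - y)) (at_left 1)"
    by (rule eventually_at_leftI[of 0], rule sums_unique[symmetric], rule inverse_sqrt_sums) auto
  have "filterlim (\<lambda>y::real. 1 / sqrt (1 - y)) at_top (at_left 1)" by real_asymp
  then have "filterlim (\<lambda>y::real. \<Sum>n. pochhammer (1/2) n / fact n * y^n) at_top (at_left 1)"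
    using filterlim_cong[OF refl refl ev] by blast
  then have "((\<lambda>y. (\<Sum>k. (1 + 3*real k) * cubic_coeff k * y^k) / (\<Sum>n. pochhammer (1/2) n / fact n * y^n))
      \<longlongrightarrow> 3 * sqrt 3 / (2 * pi)) (at_left 1)"
  proof (intro powser_ratio_tendsto_at_left_1 cubic_coeff_ratio_tendsto)
    show "summable (\<lambda>n. pochhammer (1/2) n / fact n * y^n)" if "0 \<le> y" "y < 1" for y :: real
      by (rule sums_summable[OF inverse_sqrt_sums]) (use that in auto)
  qed (auto simp: pochhammer_pos)
  then show ?thesis
    by (rule Lim_transform_eventually) (use ev in eventually_elim, simp)
qed

text \<open>The left limit of \<open>E (- t)\<close> at 1/32 is computed twice: by continuity inside
  the disc of convergence, and through the transformation.\<close>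

lemma domb_series_sum:
  "(\<lambda>n. (1 + 3*real n) * (real (Domb n) / (-32)^n)) sums (2 / pi)"
proof -
  define E where "E = (\<lambda>x. \<Sum>n. (1 + 3*real n) * real (Domb n) * x^n)"
  define H where "H = (\<lambda>y. \<Sum>k. (1 + 3*real k) * cubic_coeff k * y^k)"
  define y where "y = (\<lambda>t::real. 108*t / (1 + 16*t)^3)"
  have "isCont E (- 1/32)"
    unfolding E_def using domb_series_summable_real[of "1/20"]
    \<comment> \<open>The value 1/20 lies between 1/32 and the radius 1/16 secured by
      \<open>Domb_le\<close>.\<close>
    by (intro isCont_powser[where K = "1/20"]) auto
  then have "((\<lambda>t. E (- t)) \<longlongrightarrow> E (- 1/32)) (at_left (1/32))"
    by (rule isCont_tendsto_compose) (auto intro!: tendsto_eq_intros)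
  moreover have "((\<lambda>t. E (- t)) \<longlongrightarrow> 2 / pi) (at_left (1/32))"
  proof (rule Lim_transform_eventually)
    have ev: "eventually (\<lambda>t::real. t \<in> {0<..<1/32}) (at_left (1/32))"
      by (rule eventually_at_leftI[of 0]) auto
    have "filterlim y (at_left 1) (at_left (1/32))"
    proof (rule filterlim_at_withinI)
      show "(y \<longlongrightarrow> 1) (at_left (1/32))"
        unfolding y_def by (auto intro!: tendsto_eq_intros simp: power3_eq_cube)
      show "eventually (\<lambda>t. y t \<in> {..<1} - {1}) (at_left (1/32))"
        using ev by eventually_elim (use cubic_argument_less_1 in \<open>auto simp: y_def less_imp_neq\<close>)
    qed
    then have "((\<lambda>t. H (y t) * sqrt (1 - y t)) \<longlongrightarrow> 3 * sqrt 3 / (2 * pi)) (at_left (1/32))"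
      unfolding H_def by (rule filterlim_compose[OF cubic_series_asymp_at_left_1])
    \<comment> \<open>This is the prefactor (1 - 32t) / (1 + 16t)^2 divided by sqrt (1 - y). At t =
      1/32 one has 1 + 16t = 3/2 and 1 + 4t = 9/8.\<close>
    moreover have "((\<lambda>t::real. sqrt ((1 + 16*t) / (1 + 4*t)) / (1 + 16*t)) \<longlongrightarrow> 4 / (3 * sqrt 3))
        (at_left (1/32))"
    proof -
      have "((\<lambda>t::real. sqrt ((1 + 16*t) / (1 + 4*t)) / (1 + 16*t)) \<longlongrightarrow> sqrt (4 / 3) / (3 / 2)) (at_left (1/32))"
        by (auto intro!: tendsto_eq_intros)
      moreover have "sqrt (4 / 3) / (3 / 2) = 4 / (3 * sqrt 3)" by (simp add: real_sqrt_divide)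
      ultimately show ?thesis by (simp only:)
    qed
    ultimately have "((\<lambda>t. sqrt ((1 + 16*t) / (1 + 4*t)) / (1 + 16*t) * (H (y t) * sqrt (1 - y t)))
        \<longlongrightarrow> 4 / (3 * sqrt 3) * (3 * sqrt 3 / (2 * pi))) (at_left (1/32))"
      by (intro tendsto_mult)
    then show "((\<lambda>t. sqrt ((1 + 16*t) / (1 + 4*t)) / (1 + 16*t) * (H (y t) * sqrt (1 - y t)))
        \<longlongrightarrow> 2 / pi) (at_left (1/32))"
      by simp
    show "eventually (\<lambda>t. sqrt ((1 + 16*t) / (1 + 4*t)) / (1 + 16*t) * (H (y t) * sqrt (1 - y t)) = E (- t))
        (at_left (1/32))"
      using ev
    proof eventually_elim
      case (elim t)
      then have t: "0 \<le> t" "t < 1/32" by auto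
      have "sqrt ((1 + 16*t) / (1 + 4*t)) * sqrt (1 - y t)
          = sqrt ((1 + 16*t) / (1 + 4*t) * ((1 - 32*t)^2 * (1 + 4*t) / (1 + 16*t)^3))"
        unfolding y_def one_minus_cubic_argument[OF t(1)] by (rule real_sqrt_mult[symmetric])
      also have "(1 + 16*t) / (1 + 4*t) * ((1 - 32*t)^2 * (1 + 4*t) / (1 + 16*t)^3)
          = ((1 - 32*t) / (1 + 16*t))^2"
      proof -
        have "1 + 4*t \<noteq> 0" "1 + 16*t \<noteq> 0" using t by auto
        then show ?thesis by (simp add: power_divide power3_eq_cube power2_eq_square)
      qed
      also have "sqrt \<dots> = (1 - 32*t) / (1 + 16*t)"
        using t by (simp add: real_sqrt_abs)
      finally have "sqrt ((1 + 16*t) / (1 + 4*t)) * sqrt (1 - y t) = (1 - 32*t) / (1 + 16*t)" .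
      moreover have "a / b * (h * c) = a * c / b * h" for a b c h :: real
        by simp
      ultimately have "sqrt ((1 + 16*t) / (1 + 4*t)) / (1 + 16*t) * (H (y t) * sqrt (1 - y t))
          = (1 - 32*t) / (1 + 16*t) / (1 + 16*t) * H (y t)"
        by (simp only:)
      also have "\<dots> = E (- t)"
        unfolding E_def H_def y_def domb_series_transform_real[OF t] by (simp add: power2_eq_square)
      finally show ?case .
    qed
  qed
  ultimately have "E (- 1/32) = 2 / pi"
    by (rule tendsto_unique[rotated]) simp
  moreover have "(\<lambda>n. (1 + 3*real n) * real (Domb n) * (- 1/32)^n) sums E (- 1/32)"
    unfolding E_def by (intro summable_sums domb_series_summable_real) simp
  moreover have "(- 1/32)^n = 1 / (-32::real)^n" for n
    by (simp flip: power_one_over)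
  ultimately show ?thesis by simp
qed

section \<open>Telescoping\<close>

definition domb_scaled :: "nat \<Rightarrow> real" where
  "domb_scaled n = real (Domb n) / (-32)^n"

lemma domb_scaled_rec:
  "16 * (real n + 2)^3 * domb_scaled (n + 2)
     = - (2 * real n + 3) * (5 * real n^2 + 15 * real n + 12) * domb_scaled (n + 1)
       - (real n + 1)^3 * domb_scaled n"
proof -
  define p where "p = (-32::real)^n"
  have "p \<noteq> 0" by (simp add: p_def)
  moreover have "real (Domb n) = p * domb_scaled n" "real (Domb (n + 1)) = -32 * p * domb_scaled (n + 1)"
    "real (Domb (n + 2)) = 1024 * p * domb_scaled (n + 2)"
    by (simp_all add: domb_scaled_def p_def)
  ultimately have "64 * p * (16 * (real n + 2)^3 * domb_scaled (n + 2)
      + (2 * real n + 3) * (5 * real n^2 + 15 * real n + 12) * domb_scaled (n + 1)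
      + (real n + 1)^3 * domb_scaled n) = 0"
    using domb_rec_Domb[of n] unfolding domb_rec_def by algebra
  with \<open>p \<noteq> 0\<close> have "16 * (real n + 2)^3 * domb_scaled (n + 2)
      + (2 * real n + 3) * (5 * real n^2 + 15 * real n + 12) * domb_scaled (n + 1)
      + (real n + 1)^3 * domb_scaled n = 0" by simp
  then show ?thesis by algebra
qed

lemma abs_domb_scaled_le: "\<bar>domb_scaled n\<bar> \<le> 1 / 2^n"
proof -
  have "\<bar>domb_scaled n\<bar> = real (Domb n) / 32^n"
    by (simp add: domb_scaled_def abs_divide power_abs)
  also have "\<dots> \<le> 16^n / 32^n"
    by (intro divide_right_mono Domb_le) auto
  also have "\<dots> = 1 / 2^n"
    by (simp flip: power_divide) (simp add: power_divide)
  finally show ?thesis .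
qed

text \<open>Since the scaled numbers decay like 2^(-n), boundary terms with rational coefficients
  reduce to elementary limits.\<close>

lemma mult_domb_scaled_tendsto_0:
  assumes "(\<lambda>n. f n / 2^n) \<longlonglongrightarrow> 0"
  shows "(\<lambda>n. f n * domb_scaled n) \<longlonglongrightarrow> 0"
proof (rule Lim_null_comparison)
  show "(\<lambda>n. \<bar>f n / 2^n\<bar>) \<longlonglongrightarrow> 0" using assms by (rule tendsto_rabs_zero)
  show "eventually (\<lambda>n. norm (f n * domb_scaled n) \<le> \<bar>f n / 2^n\<bar>) sequentially"
  proof (rule always_eventually, rule allI)
    fix n
    have "\<bar>f n\<bar> * \<bar>domb_scaled n\<bar> \<le> \<bar>f n\<bar> * (1 / 2^n)"
      by (intro mult_left_mono abs_domb_scaled_le) auto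
    then show "norm (f n * domb_scaled n) \<le> \<bar>f n / 2^n\<bar>"
      by (simp add: abs_mult)
  qed
qed

text \<open>Writing \<open>d\<close> for \<open>domb_scaled\<close>, the first condition is the adjoint of the recurrence: it says that
  \<open>c(n) d(n) - A (1 + 3n) d(n)\<close> is the difference of \<open>r(n) d(n) + (n + 1)\<^sup>3 s(n) d(n + 1)\<close>, where \<open>r(n)\<close>
  is the numerator in the second condition.\<close>

definition domb_certificate :: "nat \<Rightarrow> real \<Rightarrow> (real \<Rightarrow> real) \<Rightarrow> (real \<Rightarrow> real) \<Rightarrow> bool" where
  "domb_certificate N A c s \<longleftrightarrow>
     (\<forall>x\<ge>real N. c (x + 1) = A * (4 + 3*x) - s (x + 2) * (x + 2)^3 / 16
        - (x + 1)^3 * s x - s (x + 1) * ((2*x + 3) * (5*x^2 + 15*x + 12)) / 16) \<and>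
     (\<lambda>n. (A * (1 + 3*real n) - c (real n) - s (real n + 1) * (real n + 1)^3 / 16) / 2^n) \<longlonglongrightarrow> 0 \<and>
     (\<lambda>n. real n^3 * s (real n - 1) / 2^n) \<longlonglongrightarrow> 0"

text \<open>The difference between the wanted terms and \<open>A\<close> times those of
  \<open>domb_series_sum\<close> telescopes; the boundary expression tends to 0, so only its value
  at \<open>N\<close> remains.\<close>

lemma domb_certificate_sums:
  fixes c s :: "real \<Rightarrow> real" and A :: real and N :: nat
  assumes "domb_certificate N A c s"
  shows "(\<lambda>m. c (real (m + N)) * domb_scaled (m + N)) sums
    (A * (2 / pi - (\<Sum>n<N. (1 + 3*real n) * domb_scaled n))
       - ((A * (1 + 3*real N) - c (real N) - s (real N + 1) * (real N + 1)^3 / 16) * domb_scaled N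
          + (real N + 1)^3 * s (real N) * domb_scaled (N + 1)))"
proof -
  \<comment> \<open>This choice makes the coefficient of d(n) in \<open>T (Suc n) - T n\<close>
    equal to c(n) - A (1 + 3n), once d(n + 2) is eliminated.\<close>
  define r where "r = (\<lambda>x. A * (1 + 3*x) - c x - s (x + 1) * (x + 1)^3 / 16)"
  have eq: "c (x + 1) = A * (4 + 3*x) - s (x + 2) * (x + 2)^3 / 16
      - (x + 1)^3 * s x - s (x + 1) * ((2*x + 3) * (5*x^2 + 15*x + 12)) / 16" if "real N \<le> x" for x
    using assms that unfolding domb_certificate_def by blast
  have lim: "(\<lambda>n. r (real n) / 2^n) \<longlonglongrightarrow> 0" "(\<lambda>n. real n^3 * s (real n - 1) / 2^n) \<longlonglongrightarrow> 0"
    using assms unfolding domb_certificate_def r_def by blast+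
  define T where "T = (\<lambda>n. r (real n) * domb_scaled n + (real n + 1)^3 * s (real n) * domb_scaled (n + 1))"
  have step: "T (Suc n) - T n = c (real n) * domb_scaled n - A * ((1 + 3*real n) * domb_scaled n)"
    if "N \<le> n" for n
  proof -
    define x where "x = real n"
    \<comment> \<open>The adjoint equation, in the form that makes the coefficient of d(n + 1)
      vanish.\<close>
    have rx: "r (x + 1) = (x + 1)^3 * s x + s (x + 1) * ((2*x + 3) * (5*x^2 + 15*x + 12)) / 16"
    proof -
      have "x + 1 + 1 = x + 2" by simp
      moreover have "c (x + 1) = A * (4 + 3*x) - s (x + 2) * (x + 2)^3 / 16
        - (x + 1)^3 * s x - s (x + 1) * ((2*x + 3) * (5*x^2 + 15*x + 12)) / 16"
        using eq[of x] that by (simp add: x_def)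
      ultimately show ?thesis unfolding r_def by (simp add: algebra_simps)
    qed
    have "T (Suc n) = r (x + 1) * domb_scaled (n + 1) + (x + 2)^3 * s (x + 1) * domb_scaled (n + 2)"
      by (simp add: T_def x_def add_ac)
    moreover have "16 * ((x + 2)^3 * s (x + 1) * domb_scaled (n + 2))
        = s (x + 1) * (- (2*x + 3) * (5*x^2 + 15*x + 12) * domb_scaled (n + 1) - (x + 1)^3 * domb_scaled n)"
      unfolding x_def domb_scaled_rec[symmetric] by simp
    moreover have "T n = (A * (1 + 3*x) - c x - s (x + 1) * (x + 1)^3 / 16) * domb_scaled n
        + (x + 1)^3 * s x * domb_scaled (n + 1)"
      by (simp add: T_def r_def x_def)
    ultimately show ?thesis
      unfolding rx x_def[symmetric] by (simp add: field_simps)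
  qed
  have "(\<lambda>n. r (real n) * domb_scaled n) \<longlonglongrightarrow> 0"
    by (rule mult_domb_scaled_tendsto_0[OF lim(1)])
  moreover have "(\<lambda>n. (real n + 1)^3 * s (real n) * domb_scaled (n + 1)) \<longlonglongrightarrow> 0"
    using LIMSEQ_Suc[OF mult_domb_scaled_tendsto_0[OF lim(2)]] by (simp add: add_ac)
  ultimately have "T \<longlonglongrightarrow> 0 + 0" unfolding T_def by (rule tendsto_add)
  then have "(\<lambda>m. T (m + N)) \<longlonglongrightarrow> 0" by (simp add: LIMSEQ_ignore_initial_segment)
  from telescope_sums[OF this]
  have "(\<lambda>m. c (real (m + N)) * domb_scaled (m + N)
      - A * ((1 + 3*real (m + N)) * domb_scaled (m + N))) sums (- T N)"
    using step by simp
  moreover have "(\<lambda>m. A * ((1 + 3*real (m + N)) * domb_scaled (m + N))) sums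
      (A * (2 / pi - (\<Sum>n<N. (1 + 3*real n) * domb_scaled n)))"
    using domb_series_sum unfolding domb_scaled_def by (intro sums_mult sums_split_initial_segment)
  ultimately have "(\<lambda>m. c (real (m + N)) * domb_scaled (m + N)
      - A * ((1 + 3*real (m + N)) * domb_scaled (m + N)) + A * ((1 + 3*real (m + N)) * domb_scaled (m + N)))
      sums (- T N + A * (2 / pi - (\<Sum>n<N. (1 + 3*real n) * domb_scaled n)))"
    by (rule sums_add)
  moreover have "- T N + X = X - (r (real N) * domb_scaled N + (real N + 1)^3 * s (real N) * domb_scaled (N + 1))"
    for X by (simp add: T_def)
  ultimately show ?thesis by (simp only: diff_add_cancel r_def)
qed

section \<open>Initial values and certificates for the five series\<close>

lemma domb_scaled_0: "domb_scaled 0 = 1"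
  by (simp add: domb_scaled_def Domb_def)

lemma domb_scaled_1: "domb_scaled 1 = - 1/8"
  by (simp add: domb_scaled_def Domb_def eval_nat_numeral)

lemma domb_scaled_2: "domb_scaled 2 = 7/256"
proof -
  have "Domb 2 = 28" by (simp add: Domb_def eval_nat_numeral)
  then show ?thesis by (simp add: domb_scaled_def)
qed

lemma domb_scaled_3: "domb_scaled 3 = - 1/128"
proof -
  have "Domb 3 = 256" by (simp add: Domb_def eval_nat_numeral)
  then show ?thesis by (simp add: domb_scaled_def)
qed

text \<open>The second functions were found by linear algebra over the rational functions.\<close>

lemma
  shows domb_certificate_square_up2: "domb_certificate 0 9
      (\<lambda>x. (27 + 103*x + 141*x^2 + 78*x^3 + 15*x^4) / ((x + 1)^2 * (x + 2)^2))
      (\<lambda>x. 16 / (x + 1)^2)"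
    and domb_certificate_cube_up2: "domb_certificate 0 (-81)
      (\<lambda>x. (239 + 807*x + 993*x^2 + 582*x^3 + 165*x^4 + 18*x^5) / ((x + 1)^3 * (x + 2)^3))
      (\<lambda>x. - (144*x + 224) / (x + 1)^3)"
    and domb_certificate_square_down2: "domb_certificate 2 (-9)
      (\<lambda>x. (2 + 5*x - 9*x^2 - 21*x^3 + 39*x^4) / (x^2 * (x - 1)^2))
      (\<lambda>x. - 16 / x^2)"
    and domb_certificate_cube_down2: "domb_certificate 2 81
      (\<lambda>x. (-26 - 21*x + 105*x^2 - 9*x^3 - 147*x^4 + 306*x^5) / (x^3 * (x - 1)^3))
      (\<lambda>x. (144*x - 208) / x^3)"
    and domb_certificate_square_up3: "domb_certificate 0 243
      (\<lambda>x. (5729 + 8701*x + 5895*x^2 + 1879*x^3 + 228*x^4) / ((x + 1)^2 * (x + 2)^2 * (x + 3)^2))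
      (\<lambda>x. 16 * (27*x^2 + 123*x + 151) / ((x + 1)^2 * (x + 2)^2))"
proof (unfold domb_certificate_def, goal_cases)
  case 1
  show ?case
  proof (intro conjI allI impI)
    fix x :: real assume "real 0 \<le> x"
    then have nz: "x + 1 \<noteq> 0" "x + 2 \<noteq> 0" "x + 3 \<noteq> 0" "x + 4 \<noteq> 0" by auto
    \<comment> \<open>Nested shifts are merged so that the denominators coincide with the
      expressions known to be nonzero.\<close>
    have shift: "x + 1 + 1 = x + 2" "x + 1 + 2 = x + 3" "x + 2 + 1 = x + 3"
      "x + 1 + 3 = x + 4" "x + 2 + 2 = x + 4" by simp_all
    show "(27 + 103*(x + 1) + 141*(x + 1)^2 + 78*(x + 1)^3 + 15*(x + 1)^4) / (((x + 1) + 1)^2 * ((x + 1) + 2)^2)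
        = 9 * (4 + 3*x) - 16 / ((x + 2) + 1)^2 * (x + 2)^3 / 16
          - (x + 1)^3 * (16 / (x + 1)^2) - 16 / ((x + 1) + 1)^2 * ((2*x + 3) * (5*x^2 + 15*x + 12)) / 16"
      unfolding shift using nz by (simp add: field_simps) algebra
  qed real_asymp+
next
  case 2
  show ?case
  proof (intro conjI allI impI)
    fix x :: real assume "real 0 \<le> x"
    then have nz: "x + 1 \<noteq> 0" "x + 2 \<noteq> 0" "x + 3 \<noteq> 0" "x + 4 \<noteq> 0" by auto
    have shift: "x + 1 + 1 = x + 2" "x + 1 + 2 = x + 3" "x + 2 + 1 = x + 3"
      "x + 1 + 3 = x + 4" "x + 2 + 2 = x + 4" by simp_all
    show "(239 + 807*(x + 1) + 993*(x + 1)^2 + 582*(x + 1)^3 + 165*(x + 1)^4 + 18*(x + 1)^5) / (((x + 1) + 1)^3 * ((x + 1) + 2)^3)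
        = (-81) * (4 + 3*x) - - (144*(x + 2) + 224) / ((x + 2) + 1)^3 * (x + 2)^3 / 16
          - (x + 1)^3 * (- (144*x + 224) / (x + 1)^3) - - (144*(x + 1) + 224) / ((x + 1) + 1)^3 * ((2*x + 3) * (5*x^2 + 15*x + 12)) / 16"
      unfolding shift using nz by (simp add: divide_simps) algebra
  qed real_asymp+
next
  case 3
  show ?case
  proof (intro conjI allI impI)
    fix x :: real assume "real 2 \<le> x"
    then have nz: "x \<noteq> 0" "x + 1 \<noteq> 0" "x + 2 \<noteq> 0" by auto
    have shift: "x + 1 - 1 = x" by simp
    show "(2 + 5*(x + 1) - 9*(x + 1)^2 - 21*(x + 1)^3 + 39*(x + 1)^4) / ((x + 1)^2 * ((x + 1) - 1)^2)
        = (-9) * (4 + 3*x) - - 16 / (x + 2)^2 * (x + 2)^3 / 16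
          - (x + 1)^3 * (- 16 / x^2) - - 16 / (x + 1)^2 * ((2*x + 3) * (5*x^2 + 15*x + 12)) / 16"
      unfolding shift using nz by (simp add: field_simps) algebra
  qed real_asymp+
next
  case 4
  show ?case
  proof (intro conjI allI impI)
    fix x :: real assume "real 2 \<le> x"
    then have nz: "x \<noteq> 0" "x + 1 \<noteq> 0" "x + 2 \<noteq> 0" by auto
    have shift: "x + 1 - 1 = x" by simp
    show "(-26 - 21*(x + 1) + 105*(x + 1)^2 - 9*(x + 1)^3 - 147*(x + 1)^4 + 306*(x + 1)^5) / ((x + 1)^3 * ((x + 1) - 1)^3)
        = 81 * (4 + 3*x) - (144*(x + 2) - 208) / (x + 2)^3 * (x + 2)^3 / 16
          - (x + 1)^3 * ((144*x - 208) / x^3) - (144*(x + 1) - 208) / (x + 1)^3 * ((2*x + 3) * (5*x^2 + 15*x + 12)) / 16"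
      unfolding shift using nz by (simp add: divide_simps) algebra
  qed real_asymp+
next
  case 5
  show ?case
  proof (intro conjI allI impI)
    fix x :: real assume "real 0 \<le> x"
    then have nz: "x + 1 \<noteq> 0" "x + 2 \<noteq> 0" "x + 3 \<noteq> 0" "x + 4 \<noteq> 0" by auto
    have shift: "x + 1 + 1 = x + 2" "x + 1 + 2 = x + 3" "x + 2 + 1 = x + 3"
      "x + 1 + 3 = x + 4" "x + 2 + 2 = x + 4" by simp_all
    show "(5729 + 8701*(x + 1) + 5895*(x + 1)^2 + 1879*(x + 1)^3 + 228*(x + 1)^4) / (((x + 1) + 1)^2 * ((x + 1) + 2)^2 * ((x + 1) + 3)^2)
        = 243 * (4 + 3*x) - 16 * (27*(x + 2)^2 + 123*(x + 2) + 151) / (((x + 2) + 1)^2 * ((x + 2) + 2)^2) * (x + 2)^3 / 16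
          - (x + 1)^3 * (16 * (27*x^2 + 123*x + 151) / ((x + 1)^2 * (x + 2)^2))
          - 16 * (27*(x + 1)^2 + 123*(x + 1) + 151) / (((x + 1) + 1)^2 * ((x + 1) + 2)^2) * ((2*x + 3) * (5*x^2 + 15*x + 12)) / 16"
      unfolding shift using nz by (simp add: divide_simps) algebra
  qed real_asymp+
qed

theorem theorem4p1:
  shows "((\<lambda>n::nat. (27 + 103*real n + 141*real n^2 + 78*real n^3 + 15*real n^4)
            / ((real n + 1)^2 * (real n + 2)^2) * real (Domb n) / (-32)^n) sums (18 / pi)) \<and>
         ((\<lambda>n::nat. (239 + 807*real n + 993*real n^2 + 582*real n^3 + 165*real n^4 + 18*real n^5)
            / ((real n + 1)^3 * (real n + 2)^3) * real (Domb n) / (-32)^n) sums (80 - 162 / pi)) \<and>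
         (((\<lambda>n::nat.
            (2 + 5*real n - 9*real n^2 - 21*real n^3 + 39*real n^4)
            / (real n^2 * (real n - 1)^2) * real (Domb n) / (-32)^n) \<circ> (\<lambda>m. m + 2)) sums (-9 * (2 / pi - 11 / 12))) \<and>
         (((\<lambda>n::nat.
            (-26 - 21*real n + 105*real n^2 - 9*real n^3 - 147*real n^4 + 306*real n^5)
            / (real n^3 * (real n - 1)^3) * real (Domb n) / (-32)^n) \<circ> (\<lambda>m. m + 2)) sums (162 / pi - 217 / 8)) \<and>
         ((\<lambda>n::nat. (5729 + 8701*real n + 5895*real n^2 + 1879*real n^3 + 228*real n^4)
            / ((real n + 1)^2 * (real n + 2)^2 * (real n + 3)^2) * real (Domb n) / (-32)^n) sums (486 / pi))"
proof -
  \<comment> \<open>With \<open>N\<close> = 0 the partial sum is empty, and the boundary value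
    formed from d(0) = 1 and d(1) = -1/8 is 0.\<close>
  have square_up2:
    "(\<lambda>n. (27 + 103*real n + 141*real n^2 + 78*real n^3 + 15*real n^4)
        / ((real n + 1)^2 * (real n + 2)^2) * domb_scaled n) sums (18 / pi)"
    using domb_certificate_sums[OF domb_certificate_square_up2]
    by (simp add: domb_scaled_0 domb_scaled_1[simplified])
  have cube_up2:
    "(\<lambda>n. (239 + 807*real n + 993*real n^2 + 582*real n^3 + 165*real n^4 + 18*real n^5)
        / ((real n + 1)^3 * (real n + 2)^3) * domb_scaled n) sums (80 - 162 / pi)"
    using domb_certificate_sums[OF domb_certificate_cube_up2]
    by (simp add: domb_scaled_0 domb_scaled_1[simplified])
  \<comment> \<open>The denominators vanish at n = 0 and n = 1, so the next two series start at 2.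
    In the first of them 11/12 is this 1/2 plus 5/12 from the boundary value.\<close>
  have partial_sum: "(\<Sum>n<2. (1 + 3*real n) * domb_scaled n) = 1/2"
    using domb_scaled_0 domb_scaled_1 by (simp add: numeral_2_eq_2)
  have square_down2:
    "((\<lambda>n. (2 + 5*real n - 9*real n^2 - 21*real n^3 + 39*real n^4)
        / (real n^2 * (real n - 1)^2) * domb_scaled n) \<circ> (\<lambda>m. m + 2)) sums (-9 * (2 / pi - 11 / 12))"
    using domb_certificate_sums[OF domb_certificate_square_down2]
    by (simp add: partial_sum domb_scaled_2 domb_scaled_3 o_def)
  have cube_down2:
    "((\<lambda>n. (-26 - 21*real n + 105*real n^2 - 9*real n^3 - 147*real n^4 + 306*real n^5)
        / (real n^3 * (real n - 1)^3) * domb_scaled n) \<circ> (\<lambda>m. m + 2)) sums (162 / pi - 217 / 8)"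
    using domb_certificate_sums[OF domb_certificate_cube_down2]
    by (simp add: partial_sum domb_scaled_2 domb_scaled_3 o_def)
  have square_up3:
    "(\<lambda>n. (5729 + 8701*real n + 5895*real n^2 + 1879*real n^3 + 228*real n^4)
        / ((real n + 1)^2 * (real n + 2)^2 * (real n + 3)^2) * domb_scaled n) sums (486 / pi)"
    using domb_certificate_sums[OF domb_certificate_square_up3]
    by (simp add: domb_scaled_0 domb_scaled_1[simplified])
  show ?thesis
    using square_up2 cube_up2 square_down2 cube_down2 square_up3
    unfolding domb_scaled_def times_divide_eq_right by - (intro conjI, assumption+)
qed

end
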